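(* Let $p\ge 1$ and $N\ge 3$ be integers with $p+1\le N-1$, and let $\mathsf{D}_1^{(p)}=\mathsf{H}^{-1}\mathsf{Q}\in\mathbb{R}^{N\times N}$ be a diagonal-norm generalized summation-by-parts (GSBP) operator for the first derivative of order and degree $p$ on a nodal distribution $\mathbf{x}=[x_1,\dots,x_N]^T$. If there exists a constant-coefficient second-derivative GSBP operator $\mathsf{D}_2^{(p)}\in\mathbb{R}^{N\times N}$ of order $p$ and degree $p+1$ that is order-matched to and compatible with $\mathsf{D}_1^{(p)}$, then there exists a variable-coefficient second-derivative GSBP operator $\mathsf{D}_2^{(p)}(\mathsf{B})\in\mathbb{R}^{N\times N}$ of order $p$ and degree $p+1$ that is order-matched to and compatible with $\mathsf{D}_1^{(p)}$.
   Context: Nodes: $\mathbf{x}=[x_1,\dots,x_N]^T$ is a vector of $N$ distinct real nodes, not necessarily uniform, associated with an interval $[x_L,x_R]$; the endpoints need not be nodes. For an integer $k\ge 0$, $\mathbf{x}^k=[x_1^k,\dots,x_N^k]^T$ (with $\mathbf{x}^0$ the vector of ones), and $\mathbf{x}^k=\mathbf{0}$ if $k<0$. $\operatorname{diag}(\mathbf{x}^k)$ is the diagonal matrix with $i$-th diagonal entry $x_i^k$. First-derivative GSBP operator: $\mathsf{D}_1^{(p)}=\mathsf{H}^{-1}\mathsf{Q}\in\mathbb{R}^{N\times N}$ is a GSBP operator for the first derivative of order and degree $p$ on $\mathbf{x}$ if (1) $\mathsf{D}_1^{(p)}\mathbf{x}^j=j\mathbf{x}^{j-1}$ for all integers $0\le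 j\le p$; (2) the norm matrix $\mathsf{H}$ is symmetric positive definite; (3) $\mathsf{Q}+\mathsf{Q}^T=\mathsf{E}$, where $(\mathbf{x}^i)^T\mathsf{E}\mathbf{x}^j=x_R^{i+j}-x_L^{i+j}$ for all integers $0\le i,j\le r$, for some $r\ge p$. The matrix $\mathsf{E}$ is constructed as $\mathsf{E}=\mathbf{t}_{x_R}\mathbf{t}_{x_R}^T-\mathbf{t}_{x_L}\mathbf{t}_{x_L}^T$ with vectors satisfying $\mathbf{t}_{x_R}^T\mathbf{x}^j=x_R^j$ and $\mathbf{t}_{x_L}^T\mathbf{x}^j=x_L^j$ for $0\le j\le r$. The operator is diagonal-norm if $\mathsf{H}$ is diagonal. Variable-coefficient operator: here $\mathsf{B}$ denotes a diagonal matrix $\operatorname{diag}(\mathcal{B}(x_1),\dots,\mathcal{B}(x_N))$ of nodal values of a variable coefficient $\mathcal{B}$, and $\mathsf{D}_2^{(p)}(\cdot)$ assigns to each such $\mathsf{B}$ a matrix in $\mathbb{R}^{N\times N}$ approximating $\frac{\partial}{\partial x}\left(\mathcal{B}\frac{\partial\,\cdot}{\partial x}\right)$. It is an order-matched second-derivative GSBP operator (order-matched to $\mathsf{D}_1^{(p)}=\mathsf{H}^{-1}\mathsf{Q}$), of order $p$ and degree $p+1$, if: (a) $\mathsf{D}_2^{(p)}(\operatorname{diag}(\mathbf{x}^k))\,\mathbf{x}^s=s(k+s-1)\mathbf{x}^{k+s-2}$ for all integers $k,s\ge 0$ with $k+s\le p+1$; and (b) $\mathsf{D}_2^{(p)}(\mathsf{B})=\mathsf{H}^{-1}\{-\mathsf{M}(\mathsf{B})+\mathsf{E}\mathsf{B}\mathsf{D}_b\}$,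 where $\mathsf{M}(\mathsf{B})=\sum_{i=1}^N\mathsf{B}(i,i)\mathsf{M}_i$ with each $\mathsf{M}_i\in\mathbb{R}^{N\times N}$ symmetric positive semi-definite, and $\mathsf{D}_b\in\mathbb{R}^{N\times N}$ is an approximation to the first derivative of degree at least $p+1$, i.e. $\mathsf{D}_b\mathbf{x}^j=j\mathbf{x}^{j-1}$ for all $0\le j\le p+1$. The matrices $\mathsf{M}_i$ and $\mathsf{D}_b$ do not depend on $\mathsf{B}$. Such a diagonal-norm operator is compatible with $\mathsf{D}_1^{(p)}$ if in addition $\mathsf{M}(\mathsf{B})=(\mathsf{D}_1^{(p)})^T\mathsf{H}\mathsf{B}\mathsf{D}_1^{(p)}+\mathsf{R}(\mathsf{B})$, where $\mathsf{R}(\mathsf{B})=\sum_{i=1}^N\mathsf{B}(i,i)\mathsf{R}_i$ with each $\mathsf{R}_i\in\mathbb{R}^{N\times N}$ symmetric positive semi-definite (independent of $\mathsf{B}$). Constant-coefficient operator: a matrix $\mathsf{D}_2^{(p)}\in\mathbb{R}^{N\times N}$ is a constant-coefficient second-derivative GSBP operator of order $p$ and degree $p+1$, order-matched to and compatible with the diagonal-norm operator $\mathsf{D}_1^{(p)}$, if $\mathsf{D}_2^{(p)}\mathbf{x}^k=k(k-1)\mathbf{x}^{k-2}$ for all integers $0\le k\le p+1$ and $$\mathsf{D}_2^{(p)}=\mathsf{H}^{-1}\left[-(\mathsf{D}_1^{(p)})^T\mathsf{H}\mathsf{D}_1^{(p)}-\mathsf{R}_c+\mathsf{E}\mathsf{D}_b\right],$$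 where $\mathsf{R}_c\in\mathbb{R}^{N\times N}$ is symmetric positive semi-definite and $\mathsf{D}_b\in\mathbb{R}^{N\times N}$ satisfies $\mathsf{D}_b\mathbf{x}^j=j\mathbf{x}^{j-1}$ for all $0\le j\le p+1$. *)

theory Defs
  imports "HOL-Analysis.Analysis"
begin

text \<open>Matrices and vectors are indexed by a finite type \<open>'n\<close> with \<open>N = CARD('n)\<close> elements; no order
  is imposed on the nodes \<open>x $ i\<close>, which are only assumed distinct in the theorem.\<close>

definition node_pow :: "real ^ 'n \<Rightarrow> int \<Rightarrow> real ^ 'n" where
  "node_pow x k = (if k < 0 then 0 else (\<chi> i. (x $ i) ^ nat k))"

definition diag_matrix :: "real ^ 'n \<Rightarrow> real ^ 'n ^ 'n" where
  "diag_matrix b = (\<chi> i j. if i = j then b $ i else 0)"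

definition is_diagonal :: "real ^ 'n ^ 'n \<Rightarrow> bool" where
  "is_diagonal A \<longleftrightarrow> (\<forall>i j. i \<noteq> j \<longrightarrow> A $ i $ j = 0)"

definition sym_pos_def :: "real ^ 'n ^ 'n \<Rightarrow> bool" where
  "sym_pos_def A \<longleftrightarrow> transpose A = A \<and> (\<forall>v. v \<noteq> 0 \<longrightarrow> v \<bullet> (A *v v) > 0)"

definition sym_pos_semidef :: "real ^ 'n ^ 'n \<Rightarrow> bool" where
  "sym_pos_semidef A \<longleftrightarrow> transpose A = A \<and> (\<forall>v. v \<bullet> (A *v v) \<ge> 0)"

definition outer_prod :: "real ^ 'n \<Rightarrow> real ^ 'n \<Rightarrow> real ^ 'n ^ 'n" where
  "outer_prod u v = (\<chi> i j. u $ i * v $ j)"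

definition first_deriv_exact :: "real ^ 'n \<Rightarrow> nat \<Rightarrow> real ^ 'n ^ 'n \<Rightarrow> bool" where
  "first_deriv_exact x q D \<longleftrightarrow>
     (\<forall>j\<le>q. D *v node_pow x (int j) = real j *\<^sub>R node_pow x (int j - 1))"

text \<open>The tuple \<open>(H, Q, E)\<close> is part of the data of the operator \<open>D1\<close>: the second-derivative operators
  below have to use the same \<open>H\<close> and \<open>E\<close>.\<close>

definition gsbp_first_deriv ::
  "real ^ 'n \<Rightarrow> real \<Rightarrow> real \<Rightarrow> nat \<Rightarrow> real ^ 'n ^ 'n \<Rightarrow> real ^ 'n ^ 'n \<Rightarrow> real ^ 'n ^ 'n
    \<Rightarrow> real ^ 'n ^ 'n \<Rightarrow> bool" where
  "gsbp_first_deriv x xL xR p H Q E D1 \<longleftrightarrow>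
     D1 = matrix_inv H ** Q \<and>
     first_deriv_exact x p D1 \<and>
     sym_pos_def H \<and>
     Q + transpose Q = E \<and>
     (\<exists>r\<ge>p.
        (\<forall>i\<le>r. \<forall>j\<le>r. node_pow x (int i) \<bullet> (E *v node_pow x (int j)) = xR ^ (i + j) - xL ^ (i + j)) \<and>
        (\<exists>tR tL. E = outer_prod tR tR - outer_prod tL tL \<and>
           (\<forall>j\<le>r. tR \<bullet> node_pow x (int j) = xR ^ j \<and> tL \<bullet> node_pow x (int j) = xL ^ j)))"

text \<open>A variable-coefficient operator \<open>D2\<close> is a map on matrices of which only the values at diagonal
  matrices are meaningful (and constrained). The decomposition into \<open>M i\<close> and \<open>Db\<close> is an explicit
  parameter because compatibility refers to the same \<open>M i\<close>.\<close>

definition order_matched_second_deriv ::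
  "real ^ 'n \<Rightarrow> nat \<Rightarrow> real ^ 'n ^ 'n \<Rightarrow> real ^ 'n ^ 'n \<Rightarrow> ('n \<Rightarrow> real ^ 'n ^ 'n) \<Rightarrow> real ^ 'n ^ 'n
    \<Rightarrow> (real ^ 'n ^ 'n \<Rightarrow> real ^ 'n ^ 'n) \<Rightarrow> bool" where
  "order_matched_second_deriv x p H E M Db D2 \<longleftrightarrow>
     (\<forall>k s. k + s \<le> p + 1 \<longrightarrow>
        D2 (diag_matrix (node_pow x (int k))) *v node_pow x (int s) =
          (real s * (real k + real s - 1)) *\<^sub>R node_pow x (int k + int s - 2)) \<and>
     (\<forall>B. is_diagonal B \<longrightarrow>
        D2 B = matrix_inv H ** (- (\<Sum>i\<in>UNIV. (B $ i $ i) *\<^sub>R M i) + E ** B ** Db)) \<and>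
     (\<forall>i. sym_pos_semidef (M i)) \<and>
     first_deriv_exact x (p + 1) Db"

definition compatible_second_deriv ::
  "real ^ 'n ^ 'n \<Rightarrow> real ^ 'n ^ 'n \<Rightarrow> ('n \<Rightarrow> real ^ 'n ^ 'n) \<Rightarrow> bool" where
  "compatible_second_deriv H D1 M \<longleftrightarrow>
     (\<exists>R. (\<forall>i. sym_pos_semidef (R i)) \<and>
        (\<forall>B. is_diagonal B \<longrightarrow>
           (\<Sum>i\<in>UNIV. (B $ i $ i) *\<^sub>R M i) =
             transpose D1 ** H ** B ** D1 + (\<Sum>i\<in>UNIV. (B $ i $ i) *\<^sub>R R i)))"

definition variable_coeff_gsbp ::
  "real ^ 'n \<Rightarrow> nat \<Rightarrow> real ^ 'n ^ 'n \<Rightarrow> real ^ 'n ^ 'n \<Rightarrow> real ^ 'n ^ 'n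
    \<Rightarrow> (real ^ 'n ^ 'n \<Rightarrow> real ^ 'n ^ 'n) \<Rightarrow> bool" where
  "variable_coeff_gsbp x p H E D1 D2 \<longleftrightarrow>
     (\<exists>M Db. order_matched_second_deriv x p H E M Db D2 \<and> compatible_second_deriv H D1 M)"

definition constant_coeff_gsbp ::
  "real ^ 'n \<Rightarrow> nat \<Rightarrow> real ^ 'n ^ 'n \<Rightarrow> real ^ 'n ^ 'n \<Rightarrow> real ^ 'n ^ 'n \<Rightarrow> real ^ 'n ^ 'n \<Rightarrow> bool" where
  "constant_coeff_gsbp x p H E D1 D2 \<longleftrightarrow>
     (\<forall>k\<le>p + 1. D2 *v node_pow x (int k) = (real k * (real k - 1)) *\<^sub>R node_pow x (int k - 2)) \<and>
     (\<exists>Rc Db. sym_pos_semidef Rc \<and> first_deriv_exact x (p + 1) Db \<and>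
        D2 = matrix_inv H ** (- (transpose D1 ** H ** D1) - Rc + E ** Db))"

end

theory Submission
  imports Defs
begin

text \<open>The dissipation of the constant-coefficient operator is distributed equally over the nodes:
  \<open>R\<^sub>i = R\<^sub>c / N\<close>. Summation by parts shows that \<open>-D\<^sub>1\<^sup>T H B D\<^sub>1 + E B D\<^sub>b\<close> alone is already exact
  on \<open>x^s\<close> for \<open>B = diag (x^k)\<close>, \<open>s \<le> p\<close> and \<open>k + s \<le> p + 1\<close>. Taking \<open>k = 0\<close>, exactness of
  the constant-coefficient operator forces \<open>R\<^sub>c x^s = 0\<close> for \<open>s \<le> p\<close>, so the \<open>R\<^sub>i\<close> do not disturb
  these conditions. The only remaining condition is \<open>k = 0\<close>, \<open>s = p + 1\<close>, where \<open>B\<close> is the identity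
  and both operators agree.\<close>

lemma sym_pos_def_invertible:
  assumes "sym_pos_def A"
  shows "invertible A"
proof -
  have "A *v v = 0 \<Longrightarrow> v = 0" for v
    using assms unfolding sym_pos_def_def by (metis inner_zero_right less_irrefl)
  then show ?thesis
    by (simp add: invertible_left_inverse matrix_left_invertible_ker)
qed

lemma invertible_matrix_inv:
  assumes "invertible A"
  shows "A ** matrix_inv A = mat 1 \<and> matrix_inv A ** A = mat 1"
  using assms unfolding invertible_def matrix_inv_def by (rule someI_ex)

lemma matrix_vector_mult_minus_left: "(- A) *v v = - (A *v (v :: real ^ 'n))"
  using matrix_vector_mult_diff_rdistrib [of 0 A v] by simp

text \<open>A unit vector turns the quadratic form into a diagonal entry.\<close>

lemma sym_pos_def_diag_nonneg:
  assumes "sym_pos_def A"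
  shows "A $ i $ i \<ge> 0"
proof -
  have "axis i 1 \<bullet> (A *v axis i 1) > 0"
    using assms by (simp add: sym_pos_def_def axis_eq_0_iff)
  then show ?thesis
    by (simp add: inner_axis' matrix_vector_mul_component inner_axis)
qed

lemma transpose_diag_matrix: "transpose (diag_matrix b) = diag_matrix b"
  by (auto simp: transpose_def diag_matrix_def vec_eq_iff)

lemma diag_matrix_mult_vec: "diag_matrix b *v v = (\<chi> i. b $ i * v $ i)"
  by (simp add: diag_matrix_def matrix_vector_mult_def vec_eq_iff if_distrib [of "\<lambda>c. c * _"] cong: if_cong)

lemma is_diagonal_diag_matrix: "is_diagonal (diag_matrix b)"
  by (simp add: is_diagonal_def diag_matrix_def)

lemma sym_pos_semidef_diag_matrix:
  assumes "\<And>i. b $ i \<ge> 0"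
  shows "sym_pos_semidef (diag_matrix b)"
proof -
  have "v \<bullet> (diag_matrix b *v v) = (\<Sum>i\<in>UNIV. b $ i * (v $ i)\<^sup>2)" for v
    by (simp add: diag_matrix_mult_vec inner_vec_def power2_eq_square mult_ac)
  then show ?thesis
    using assms by (simp add: sym_pos_semidef_def transpose_diag_matrix sum_nonneg)
qed

lemma matrix_transpose_add: "transpose (A + B) = transpose A + transpose (B :: real ^ 'n ^ 'm)"
  by (simp add: transpose_def vec_eq_iff)

lemma matrix_add_rdistrib: "(A + B) ** C = A ** C + B ** (C :: 'a::semiring_1 ^ 'm ^ 'n)"
  by (simp add: matrix_matrix_mult_def vec_eq_iff sum.distrib distrib_right)

lemma sym_pos_semidef_add:
  assumes "sym_pos_semidef A" and "sym_pos_semidef B"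
  shows "sym_pos_semidef (A + B)"
  using assms
  by (simp add: sym_pos_semidef_def matrix_transpose_add matrix_vector_mult_add_rdistrib inner_add_right)

lemma sym_pos_semidef_scaleR:
  assumes "sym_pos_semidef A" and "c \<ge> 0"
  shows "sym_pos_semidef (c *\<^sub>R A)"
  using assms
  by (simp add: sym_pos_semidef_def transpose_scalar scaleR_matrix_vector_assoc [symmetric])

lemma sym_pos_semidef_congruence:
  assumes "sym_pos_semidef A"
  shows "sym_pos_semidef (transpose C ** A ** C)"
proof -
  have "v \<bullet> ((transpose C ** A ** C) *v v) = (C *v v) \<bullet> (A *v (C *v v))" for v
    by (metis dot_lmul_matrix matrix_vector_mul_assoc vector_transpose_matrix)
  then show ?thesis
    using assms by (simp add: sym_pos_semidef_def matrix_transpose_mul matrix_mul_assoc)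
qed

lemma diag_matrix_node_pow_mult:
  "diag_matrix (node_pow x (int k)) *v node_pow x (int j) = node_pow x (int (k + j))"
  by (simp add: diag_matrix_mult_vec node_pow_def power_add nat_add_distrib vec_eq_iff)

lemma diag_matrix_node_pow_0: "diag_matrix (node_pow x 0) = mat 1"
  by (simp add: diag_matrix_def node_pow_def mat_def vec_eq_iff)

lemma diag_matrix_mult_deriv:
  assumes "first_deriv_exact x q D" and "s \<le> q"
  shows "diag_matrix (node_pow x (int k)) *v (D *v node_pow x (int s)) =
    real s *\<^sub>R node_pow x (int k + int s - 1)"
\<comment> \<open>For \<open>s = 0\<close> both sides vanish: \<open>D\<close> annihilates constants
  and the right-hand factor is zero. Otherwise \<open>s - 1\<close> is a natural exponent, so powers
  multiply as usual.\<close>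
proof (cases s)
  case 0
  then show ?thesis
    using assms(1)[unfolded first_deriv_exact_def, rule_format, of 0] by simp
next
  case (Suc j)
  then have "D *v node_pow x (int s) = real s *\<^sub>R node_pow x (int j)"
    using assms(1)[unfolded first_deriv_exact_def, rule_format, of s] \<open>s \<le> q\<close> by simp
  then show ?thesis
    using Suc diag_matrix_node_pow_mult [of x k j]
    by (simp add: matrix_vector_mult_scaleR)
qed

text \<open>With w = x^(k+s-1), both \<open>B D1\<close> and \<open>B Db\<close> send x^s to s w.
  Since \<open>D1\<^sup>T H = Q\<^sup>T\<close>, the left side is s (E - Q^T) w = s Q w = s H D1 w,
  and \<open>D1\<close> differentiates w exactly because k+s-1 is at most p.\<close>

lemma sbp_variable_coeff_exact:
  fixes x :: "real ^ 'n" and H Q E D1 Db :: "real ^ 'n ^ 'n"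
  assumes D1: "first_deriv_exact x p D1" and Db: "first_deriv_exact x (p + 1) Db"
    and H: "transpose H = H" and Q: "H ** D1 = Q" and E: "Q + transpose Q = E"
    and s: "s \<le> p" and ks: "k + s \<le> p + 1"
  defines "B \<equiv> diag_matrix (node_pow x (int k))"
  shows "(- (transpose D1 ** H ** B ** D1) + E ** B ** Db) *v node_pow x (int s) =
    H *v ((real s * (real k + real s - 1)) *\<^sub>R node_pow x (int k + int s - 2))"
proof -
  define w where "w = node_pow x (int k + int s - 1)"
  have "transpose D1 ** H = transpose Q"
    using H Q by (metis matrix_transpose_mul)
  then have "(- (transpose D1 ** H ** B ** D1) + E ** B ** Db) *v node_pow x (int s)
      = - (transpose Q *v (real s *\<^sub>R w)) + E *v (real s *\<^sub>R w)"
    using diag_matrix_mult_deriv [OF D1 s] diag_matrix_mult_deriv [OF Db, of s] s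
    by (simp add: B_def w_def matrix_vector_mult_diff_rdistrib
        matrix_vector_mul_assoc [symmetric] del: transpose_matrix_vector)
  also have "\<dots> = Q *v (real s *\<^sub>R w)"
    by (simp add: matrix_vector_mult_add_rdistrib flip: E)
  also have "\<dots> = H *v (real s *\<^sub>R (D1 *v w))"
    by (simp add: matrix_vector_mult_scaleR matrix_vector_mul_assoc Q)
  also have "real s *\<^sub>R (D1 *v w) =
      (real s * (real k + real s - 1)) *\<^sub>R node_pow x (int k + int s - 2)"
  \<comment> \<open>Only for s > 0 is w sure to be a genuine power; for s = 0 the factor s removes
    both sides.\<close>
  proof (cases s)
    case (Suc j)
    then have w: "w = node_pow x (int (k + j))"
      by (simp add: w_def)
    have "D1 *v w = real (k + j) *\<^sub>R node_pow x (int (k + j) - 1)"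
      using D1 ks Suc unfolding w first_deriv_exact_def by auto
    then show ?thesis
      using Suc by (simp add: algebra_simps)
  qed simp
  finally show ?thesis .
qed

theorem theorem4p5:
  fixes x :: "real ^ 'n" and xL xR :: real and p :: nat
    and H Q E D1 :: "real ^ 'n ^ 'n"
  assumes "p \<ge> 1" and "CARD('n) \<ge> 3" and "p + 1 \<le> CARD('n) - 1"
    and "inj (\<lambda>i. x $ i)" and "xL < xR"
    and "gsbp_first_deriv x xL xR p H Q E D1" and "is_diagonal H"
    and "\<exists>D2 :: real ^ 'n ^ 'n. constant_coeff_gsbp x p H E D1 D2"
  shows "\<exists>D2 :: real ^ 'n ^ 'n \<Rightarrow> real ^ 'n ^ 'n. variable_coeff_gsbp x p H E D1 D2"
proof -
  from assms have D1: "first_deriv_exact x p D1" and spd: "sym_pos_def H"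
    and E: "Q + transpose Q = E" and D1_eq: "D1 = matrix_inv H ** Q"
    unfolding gsbp_first_deriv_def by blast+
  from spd have Ht: "transpose H = H"
    by (simp add: sym_pos_def_def)
  have inv: "H ** matrix_inv H = mat 1" "matrix_inv H ** H = mat 1"
    using invertible_matrix_inv [OF sym_pos_def_invertible [OF spd]] by auto
  have Q: "H ** D1 = Q"
    by (simp add: D1_eq matrix_mul_assoc inv)
  from assms obtain C Rc Db where
    C_exact: "\<And>k. k \<le> p + 1 \<Longrightarrow>
      C *v node_pow x (int k) = (real k * (real k - 1)) *\<^sub>R node_pow x (int k - 2)"
    and Rc: "sym_pos_semidef Rc" and Db: "first_deriv_exact x (p + 1) Db"
    and C: "C = matrix_inv H ** (- (transpose D1 ** H ** D1) - Rc + E ** Db)"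
    unfolding constant_coeff_gsbp_def by metis
  note exact = sbp_variable_coeff_exact [OF D1 Db Ht Q E]
  have HC: "H ** C = - (transpose D1 ** H ** D1) + E ** Db - Rc"
    by (simp add: C matrix_mul_assoc inv)
  \<comment> \<open>Instance k = 0 of \<open>exact\<close>: the terms of \<open>H ** C\<close>
    without \<open>Rc\<close> already give \<open>H\<close> times the exact second derivative, as
    does \<open>H ** C\<close> itself, so their difference vanishes.\<close>
  have Rc_null: "Rc *v node_pow x (int s) = 0" if "s \<le> p" for s
  proof -
    have "H *v (C *v node_pow x (int s)) =
        (- (transpose D1 ** H ** D1) + E ** Db) *v node_pow x (int s) - Rc *v node_pow x (int s)"
      by (simp add: matrix_vector_mul_assoc HC matrix_vector_mult_diff_rdistrib)
    then show ?thesis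
      using exact [of s 0] C_exact [of s] that by (simp add: diag_matrix_node_pow_0)
  qed
  \<comment> \<open>The diagonal matrix units: each diagonal \<open>B\<close> is the combination of
    the \<open>e i\<close> with coefficients \<open>B $ i $ i\<close>.\<close>
  define e :: "'n \<Rightarrow> real ^ 'n ^ 'n" where "e i = diag_matrix (axis i 1)" for i
  \<comment> \<open>Weights summing to one make the total dissipation \<open>Rc\<close> when
    \<open>B\<close> is the identity; their nonnegativity keeps each \<open>R i\<close>
    semidefinite.\<close>
  define R :: "'n \<Rightarrow> real ^ 'n ^ 'n" where "R i = (1 / real CARD('n)) *\<^sub>R Rc" for i
  define M where "M i = transpose D1 ** (H ** e i) ** D1 + R i" for i
  define S where "S B = (\<Sum>i\<in>UNIV. (B $ i $ i) *\<^sub>R M i)" for B :: "real ^ 'n ^ 'n"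
  define D2 where "D2 B = matrix_inv H ** (- S B + E ** B ** Db)" for B
  have R_psd: "sym_pos_semidef (R i)" for i
    unfolding R_def by (intro sym_pos_semidef_scaleR Rc) simp
  have M_psd: "sym_pos_semidef (M i)" for i
  proof -
    \<comment> \<open>Diagonality of \<open>H\<close> leaves one nonnegative entry in
      \<open>H ** e i\<close>, so a congruence by \<open>D1\<close> preserves
      semidefiniteness.\<close>
    have "H ** e i = diag_matrix (axis i (H $ i $ i))"
      using \<open>is_diagonal H\<close>
      by (auto simp: e_def diag_matrix_def is_diagonal_def matrix_matrix_mult_def vec_eq_iff axis_def
          if_distrib [of "\<lambda>c. _ * c"] cong: if_cong)
    moreover have "sym_pos_semidef (diag_matrix (axis i (H $ i $ i)))"
      by (rule sym_pos_semidef_diag_matrix) (simp add: axis_def sym_pos_def_diag_nonneg [OF spd])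
    ultimately show ?thesis
      unfolding M_def by (metis sym_pos_semidef_add sym_pos_semidef_congruence R_psd)
  qed
  have S: "S B = transpose D1 ** H ** B ** D1 + (\<Sum>i\<in>UNIV. (B $ i $ i) *\<^sub>R R i)"
    if "is_diagonal B" for B
  proof -
    have B: "B = (\<Sum>i\<in>UNIV. (B $ i $ i) *\<^sub>R e i)"
      unfolding vec_eq_iff
    proof (intro allI)
      fix i j
      show "B $ i $ j = (\<Sum>i\<in>UNIV. (B $ i $ i) *\<^sub>R e i) $ i $ j"
        using that
        by (cases "i = j") (simp_all add: e_def diag_matrix_def is_diagonal_def axis_def
            if_distrib [of "\<lambda>c. _ * c"] cong: if_cong)
    qed
    have lin: "linear (\<lambda>B. transpose D1 ** H ** B ** D1)"
      by (rule linearI) (simp_all add: matrix_add_ldistrib matrix_add_rdistrib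
          matrix_scalar_ac scalar_matrix_assoc [symmetric])
    have "transpose D1 ** H ** B ** D1 =
        (\<Sum>i\<in>UNIV. (B $ i $ i) *\<^sub>R (transpose D1 ** H ** e i ** D1))"
      by (subst B) (simp only: linear_sum [OF lin] linear_cmul [OF lin])
    then show ?thesis
      by (simp add: S_def M_def matrix_mul_assoc scaleR_add_right sum.distrib)
  qed
  have D2_exact: "D2 (diag_matrix (node_pow x (int k))) *v node_pow x (int s) =
      (real s * (real k + real s - 1)) *\<^sub>R node_pow x (int k + int s - 2)"
    if ks: "k + s \<le> p + 1" for k s
  proof (cases "s \<le> p")
    case True
    define B where "B = diag_matrix (node_pow x (int k))"
    \<comment> \<open>Every \<open>R i\<close> is a multiple of \<open>Rc\<close>, so it annihilates
      x^s whatever the entries of \<open>B\<close>.\<close>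
    have "(\<Sum>i\<in>UNIV. (B $ i $ i) *\<^sub>R R i) *v node_pow x (int s) = 0"
      using Rc_null [OF True]
      by (simp add: R_def scaleR_matrix_vector_assoc [symmetric]
          flip: scaleR_sum_left sum_divide_distrib)
    then have "(- S B + E ** B ** Db) *v node_pow x (int s) =
        (- (transpose D1 ** H ** B ** D1) + E ** B ** Db) *v node_pow x (int s)"
      using S [of B]
      by (simp add: B_def is_diagonal_diag_matrix matrix_vector_mult_add_rdistrib
          matrix_vector_mult_diff_rdistrib matrix_vector_mult_minus_left)
    also have "\<dots> = H *v ((real s * (real k + real s - 1)) *\<^sub>R node_pow x (int k + int s - 2))"
      unfolding B_def by (rule exact [OF True ks])
    finally show ?thesis
      unfolding D2_def B_def [symmetric]
      \<comment> \<open>Splitting the product exposes \<open>matrix_inv H\<close> acting on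
        \<open>H\<close> times the exact value; regrouping cancels the two.\<close>
      by (simp only: matrix_vector_mul_assoc [symmetric])
         (simp only: matrix_vector_mul_assoc inv matrix_vector_mul_lid)
  next
    case False
    \<comment> \<open>\<open>Rc_null\<close> does not reach degree p+1, but here the coefficient is
      constant and \<open>D2\<close> reduces to \<open>C\<close>, whose exactness is given.\<close>
    with ks have k: "k = 0" and s: "s = p + 1"
      by auto
    have "(\<Sum>i\<in>UNIV. (mat 1 :: real ^ 'n ^ 'n) $ i $ i *\<^sub>R R i) = Rc"
      by (simp add: mat_def R_def sum_constant_scaleR del: sum_constant)
    then have "S (mat 1) = transpose D1 ** H ** D1 + Rc"
      using S [of "mat 1"] is_diagonal_diag_matrix [of "node_pow x 0"]
      by (simp add: diag_matrix_node_pow_0)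
    then have "D2 (mat 1) = C"
      by (simp add: D2_def C)
    then show ?thesis
      using C_exact [of s] k s by (simp add: diag_matrix_node_pow_0)
  qed
  have "order_matched_second_deriv x p H E M Db D2"
    unfolding order_matched_second_deriv_def using D2_exact M_psd Db by (simp add: D2_def S_def)
  moreover have "compatible_second_deriv H D1 M"
    unfolding compatible_second_deriv_def using R_psd S by (auto simp: S_def)
  ultimately show ?thesis
    unfolding variable_coeff_gsbp_def by blast
qed

end
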